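(* Let $G$ be a finite simple graph with vertices $v_1,\ldots,v_n$, let $w_0$ be a weight of $G$, let $a_0=\chi(G,w_0)$, let $C_0$ be an $(\mathcal L_{a_0},w_0)$-coloring of $G$, and let $w$ be a weight of $G$ with $\vec w\ge\vec w_0$. Then $$\chi(G,w,C_0)\le a_0+\min_{\vec w'\in\vec\delta(G,\mathcal L_{a_0},C_0,w)}\chi(G,w').$$
   Context: For an integer $a\ge1$, $\mathcal L_a$ is the list assigning $\{1,\ldots,a\}$ to every vertex. A weight is a map $w:V(G)\to\mathbb N$ with weight-vector $\vec w=\sum_i w(v_i)\vec e_i\in\mathbb N^n$ (and conversely a vector $\vec w'\in\mathbb N^n$ determines a weight $w'$). For a list $L$ (finite sets $L(v)\subset\mathbb N$), an $(L,w)$-coloring is a map $C$ with $C(v)\subset L(v)$, $|C(v)|=w(v)$ and $C(v)\cap C(v')=\emptyset$ for every edge $vv'$; $\vec w(C)=\sum_i|C(v_i)|\vec e_i$. The weighted chromatic number $\chi(G,w)$ is the smallest integer $a\ge1$ such that $G$ is $(\mathcal L_a,w)$-colorable. $\vec y\le\vec x$ means coordinatewise inequality; $\min(\vec x,\vec y)$ is the coordinatewise minimum. For a coloring $C$ and $\vec d\in\mathbb N^n$, $\mathcal C^-(C,\vec d)$ is the set of maps $C'$ with $C'(v)\subset C(v)$ for all $v$ and $\vec w(C')=\vec w(C)-\vec d$. $\chi(G,w,C_0)$ is the smallest $a$ such that there exists an $(\mathcal L_a,w)$-coloring $C$ of $G$ with $C_0\in\mathcal C^-(C,\vec w-\vec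 w_0)$. For $N\subset V(G)$, $\vec N=\sum_i\lambda_i\vec e_i$ ($\lambda_i=1$ iff $v_i\in N$). For a list $L$ with $\overline L=\bigcup_vL(v)$ and a color $x$, $G^x$ is the subgraph induced by the vertices $v$ with $x\in L(v)$; $\overrightarrow{MIS}(H)=\{\vec N: N$ a maximal (w.r.t. inclusion) independent set of $H\}$; $\overrightarrow{W}_{max}(G,L)=\sum_{x\in\overline L}\overrightarrow{MIS}(G^x)$ (vectorial sum of sets). $\overrightarrow{W}_{max}(G,\mathcal L_{a_0},C_0)$ is the set of $\vec w_1\in\overrightarrow{W}_{max}(G,\mathcal L_{a_0})$ such that there is an $(\mathcal L_{a_0},w_1)$-coloring $C_1$ with $C_0\in\mathcal C^-(C_1,\vec w_1-\vec w_0)$. Finally $\vec\delta(G,\mathcal L_{a_0},C_0,w)=\{\vec w-\min(\vec w,\vec w_1):\vec w_1\in\overrightarrow{W}_{max}(G,\mathcal L_{a_0},C_0)\}$. *)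

theory Defs
  imports
    "Graph_Theory.Digraph_Component"
    "HOL-Library.Indicator_Function"
    "HOL-Library.Function_Algebras"
    "HOL-Library.Set_Algebras"
begin

text \<open>
  A finite simple graph is a \<open>graph\<close> in the sense of the library: a finite, loop-free,
  symmetric digraph without parallel arcs, where an undirected edge is a pair of opposite arcs.
  Weights and vectors indexed by the vertices are functions \<open>'a \<Rightarrow> nat\<close>, of which only the values
  on \<open>verts G\<close> matter; the same holds for lists and colorings \<open>'a \<Rightarrow> nat set\<close>.
\<close>

definition const_list :: "nat \<Rightarrow> 'a \<Rightarrow> nat set" where
  "const_list a = (\<lambda>v. {1..a})"

text \<open>Lists \<open>L\<close> are meant to be finite, so that \<open>card\<close> is the true cardinality.\<close>

definition is_coloring ::
  "('a,'b) pre_digraph \<Rightarrow> ('a \<Rightarrow> nat set) \<Rightarrow> ('a \<Rightarrow> nat) \<Rightarrow> ('a \<Rightarrow> nat set) \<Rightarrow> bool" where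
  "is_coloring G L w C \<longleftrightarrow>
     (\<forall>v \<in> verts G. C v \<subseteq> L v \<and> card (C v) = w v) \<and>
     (\<forall>u v. u \<rightarrow>\<^bsub>G\<^esub> v \<longrightarrow> C u \<inter> C v = {})"

definition chromatic_number :: "('a,'b) pre_digraph \<Rightarrow> ('a \<Rightarrow> nat) \<Rightarrow> nat" where
  "chromatic_number G w = (LEAST a. 1 \<le> a \<and> (\<exists>C. is_coloring G (const_list a) w C))"

text \<open>The equation between weight vectors is stated in the integers, so that the subtraction is
  not truncated.\<close>

definition sub_colorings ::
  "('a,'b) pre_digraph \<Rightarrow> ('a \<Rightarrow> nat set) \<Rightarrow> ('a \<Rightarrow> nat) \<Rightarrow> ('a \<Rightarrow> nat set) set" where
  "sub_colorings G C d =
     {C'. \<forall>v \<in> verts G. C' v \<subseteq> C v \<and> int (card (C' v)) = int (card (C v)) - int (d v)}"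

text \<open>In the notions relative to a coloring \<open>C0\<close>, the weight \<open>w0\<close> of \<open>C0\<close> is an explicit
  argument. The differences \<open>w v - w0 v\<close> and \<open>w1 v - w0 v\<close> below are never really truncated: if
  \<open>C0\<close> has weight \<open>w0\<close>, membership in \<open>sub_colorings\<close> forces \<open>w0 v \<le> w v\<close>, resp.
  \<open>w0 v \<le> w1 v\<close>.\<close>

definition chromatic_number_ext ::
  "('a,'b) pre_digraph \<Rightarrow> ('a \<Rightarrow> nat) \<Rightarrow> ('a \<Rightarrow> nat) \<Rightarrow> ('a \<Rightarrow> nat set) \<Rightarrow> nat" where
  "chromatic_number_ext G w w0 C0 =
     (LEAST a. 1 \<le> a \<and>
        (\<exists>C. is_coloring G (const_list a) w C \<and> C0 \<in> sub_colorings G C (\<lambda>v. w v - w0 v)))"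

definition independent_set :: "('a,'b) pre_digraph \<Rightarrow> 'a set \<Rightarrow> bool" where
  "independent_set H N \<longleftrightarrow> N \<subseteq> verts H \<and> (\<forall>u \<in> N. \<forall>v \<in> N. \<not> u \<rightarrow>\<^bsub>H\<^esub> v)"

definition maximal_independent_set :: "('a,'b) pre_digraph \<Rightarrow> 'a set \<Rightarrow> bool" where
  "maximal_independent_set H N \<longleftrightarrow>
     independent_set H N \<and> (\<forall>M. independent_set H M \<and> N \<subseteq> M \<longrightarrow> M = N)"

definition MIS_vec :: "('a,'b) pre_digraph \<Rightarrow> ('a \<Rightarrow> nat) set" where
  "MIS_vec H = {indicator N | N. maximal_independent_set H N}"

definition color_subgraph ::
  "('a,'b) pre_digraph \<Rightarrow> ('a \<Rightarrow> nat set) \<Rightarrow> nat \<Rightarrow> ('a,'b) pre_digraph" where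
  "color_subgraph G L x = G \<restriction> {v \<in> verts G. x \<in> L v}"

text \<open>The sum is the elementwise (Minkowski) sum of sets of vectors.\<close>

definition W_max :: "('a,'b) pre_digraph \<Rightarrow> ('a \<Rightarrow> nat set) \<Rightarrow> ('a \<Rightarrow> nat) set" where
  "W_max G L = (\<Sum>x \<in> (\<Union>v \<in> verts G. L v). MIS_vec (color_subgraph G L x))"

definition W_max_ext ::
  "('a,'b) pre_digraph \<Rightarrow> ('a \<Rightarrow> nat set) \<Rightarrow> ('a \<Rightarrow> nat) \<Rightarrow> ('a \<Rightarrow> nat set) \<Rightarrow> ('a \<Rightarrow> nat) set" where
  "W_max_ext G L w0 C0 =
     {w1 \<in> W_max G L.
        \<exists>C1. is_coloring G L w1 C1 \<and> C0 \<in> sub_colorings G C1 (\<lambda>v. w1 v - w0 v)}"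

definition delta_vec ::
  "('a,'b) pre_digraph \<Rightarrow> ('a \<Rightarrow> nat set) \<Rightarrow> ('a \<Rightarrow> nat) \<Rightarrow> ('a \<Rightarrow> nat set) \<Rightarrow> ('a \<Rightarrow> nat)
     \<Rightarrow> ('a \<Rightarrow> nat) set" where
  "delta_vec G L w0 C0 w = {(\<lambda>v. w v - min (w v) (w1 v)) | w1. w1 \<in> W_max_ext G L w0 C0}"

end

theory Submission
  imports Defs
begin

text \<open>
  Let \<open>w1\<close> be a vector of \<open>W_max_ext\<close> and \<open>C1\<close> a coloring of weight \<open>w1\<close> that extends \<open>C0\<close>. Cut
  \<open>C1\<close> down to weight \<open>min w w1\<close> while keeping \<open>C0\<close> inside, and color the missing weight
  \<open>w - min w w1\<close> optimally with fresh colors, all larger than \<open>a0\<close>. The minimum over \<open>w1\<close> is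
  attained, because \<open>W_max_ext\<close> is finite and it is nonempty: enlarging each color class of \<open>C0\<close>
  to a maximal independent set gives an element.
\<close>

lemma sum_apply: "(\<Sum>x\<in>A. f x) v = (\<Sum>x\<in>A. f x v)"
  for f :: "'b \<Rightarrow> 'a \<Rightarrow> 'c::comm_monoid_add"
  by (induction A rule: infinite_finite_induct) simp_all

lemma finite_set_sum:
  fixes S :: "'b \<Rightarrow> 'c::comm_monoid_add set"
  assumes "\<And>x. x \<in> A \<Longrightarrow> finite (S x)"
  shows "finite (\<Sum>x\<in>A. S x)"
  using assms by (induction A rule: infinite_finite_induct) (auto simp: finite_set_plus)

lemma sum_in_set_sum:
  fixes S :: "'b \<Rightarrow> 'c::comm_monoid_add set"
  assumes "\<And>x. x \<in> A \<Longrightarrow> f x \<in> S x"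
  shows "(\<Sum>x\<in>A. f x) \<in> (\<Sum>x\<in>A. S x)"
  using assms by (induction A rule: infinite_finite_induct) auto

lemma ex_maximal_independent_superset:
  assumes "finite (verts H)" "independent_set H N"
  shows "\<exists>M. N \<subseteq> M \<and> maximal_independent_set H M"
proof -
  have "finite {M. independent_set H M}"
    by (rule finite_subset[of _ "Pow (verts H)"]) (use assms(1) in \<open>auto simp: independent_set_def\<close>)
  from finite_has_maximal2[OF this, of N] assms(2) obtain M
    where "independent_set H M" "N \<subseteq> M" "\<forall>K. independent_set H K \<longrightarrow> M \<subseteq> K \<longrightarrow> M = K"
    by auto
  then show ?thesis
    unfolding maximal_independent_set_def by blast
qed

lemma finite_MIS_vec:
  assumes "finite (verts H)"
  shows "finite (MIS_vec H)"
proof (rule finite_subset)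
  show "MIS_vec H \<subseteq> indicator ` Pow (verts H)"
    by (auto simp: MIS_vec_def maximal_independent_set_def independent_set_def)
qed (use assms in simp)

lemma (in fin_digraph) finite_W_max: "finite (W_max G L)"
  unfolding W_max_def
  by (intro finite_set_sum finite_MIS_vec) (simp add: color_subgraph_def)

lemma (in wf_digraph) independent_set_color_subgraph_iff:
  "independent_set (color_subgraph G L x) N \<longleftrightarrow> independent_set G N \<and> (\<forall>v\<in>N. x \<in> L v)"
proof -
  have adj_induce: "u \<rightarrow>\<^bsub>G \<restriction> S\<^esub> v \<longleftrightarrow> u \<in> S \<and> v \<in> S \<and> u \<rightarrow>\<^bsub>G\<^esub> v" for S u v
    by (auto simp: arcs_ends_def arc_to_ends_def image_def)
  show ?thesis
    by (simp add: independent_set_def color_subgraph_def adj_induce) blast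
qed

lemma finite_const_list [simp]: "finite (const_list a v)"
  by (simp add: const_list_def)

definition color_class :: "('a,'b) pre_digraph \<Rightarrow> ('a \<Rightarrow> nat set) \<Rightarrow> nat \<Rightarrow> 'a set" where
  "color_class G C x = {v \<in> verts G. x \<in> C v}"

lemma (in wf_digraph) is_coloring_iff_independent_color_classes:
  "is_coloring G L w C \<longleftrightarrow>
     (\<forall>v \<in> verts G. card (C v) = w v) \<and>
     (\<forall>x. independent_set (color_subgraph G L x) (color_class G C x))"
  unfolding independent_set_color_subgraph_iff
  unfolding is_coloring_def independent_set_def color_class_def
  using adj_in_verts by blast

definition extends_coloring ::
  "('a,'b) pre_digraph \<Rightarrow> ('a \<Rightarrow> nat set) \<Rightarrow> ('a \<Rightarrow> nat set) \<Rightarrow> bool" where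
  "extends_coloring G C C' \<longleftrightarrow> (\<forall>v \<in> verts G. C' v \<subseteq> C v)"

lemma finite_coloring:
  assumes "is_coloring G L w C" "v \<in> verts G" "finite (L v)"
  shows "finite (C v)"
  using assms by (auto simp: is_coloring_def intro: finite_subset)

lemma in_sub_colorings_diff_iff:
  assumes C: "is_coloring G L w C" and fin: "\<And>v. v \<in> verts G \<Longrightarrow> finite (L v)"
    and C': "is_coloring G L' w' C'"
  shows "C' \<in> sub_colorings G C (\<lambda>v. w v - w' v) \<longleftrightarrow> extends_coloring G C C'"
proof -
  have "int (card (C' v)) = int (card (C v)) - int (w v - w' v)"
    if "v \<in> verts G" "C' v \<subseteq> C v" for v
  proof -
    have "card (C' v) \<le> card (C v)"
      using finite_coloring[OF C] fin that by (intro card_mono) auto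
    then show ?thesis
      using C C' that(1) by (simp add: is_coloring_def)
  qed
  then show ?thesis
    by (auto simp: sub_colorings_def extends_coloring_def)
qed

lemma is_coloring_mono:
  assumes "is_coloring G L w C" "\<And>v. v \<in> verts G \<Longrightarrow> L v \<subseteq> L' v"
  shows "is_coloring G L' w C"
  using assms unfolding is_coloring_def by blast

lemma (in wf_digraph) is_coloring_image:
  assumes C: "is_coloring G L w C" and inj: "inj_on f (\<Union>v\<in>verts G. L v)"
  shows "is_coloring G (\<lambda>v. f ` L v) w (\<lambda>v. f ` C v)"
  unfolding is_coloring_def
proof (intro conjI ballI allI impI)
  have sub: "C v \<subseteq> (\<Union>v\<in>verts G. L v)" if "v \<in> verts G" for v
    using C that by (auto simp: is_coloring_def)
  show "f ` C v \<subseteq> f ` L v" if "v \<in> verts G" for v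
    using C that by (auto simp: is_coloring_def)
  show "card (f ` C v) = w v" if "v \<in> verts G" for v
    using C that card_image[OF inj_on_subset[OF inj sub]] by (simp add: is_coloring_def)
  show "f ` C u \<inter> f ` C v = {}" if "u \<rightarrow>\<^bsub>G\<^esub> v" for u v
    using C that inj_on_image_Int[OF inj sub sub, of u v] adj_in_verts[OF that]
    by (simp add: is_coloring_def)
qed

lemma (in wf_digraph) is_coloring_Un:
  assumes C1: "is_coloring G L1 w1 C1" and C2: "is_coloring G L2 w2 C2"
    and fin: "\<And>v. v \<in> verts G \<Longrightarrow> finite (L1 v) \<and> finite (L2 v)"
    and disj: "\<And>u v. u \<in> verts G \<Longrightarrow> v \<in> verts G \<Longrightarrow> L1 u \<inter> L2 v = {}"
  shows "is_coloring G (\<lambda>v. L1 v \<union> L2 v) (\<lambda>v. w1 v + w2 v) (\<lambda>v. C1 v \<union> C2 v)"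
  unfolding is_coloring_def
proof (intro conjI ballI allI impI)
  have disjoint: "C1 u \<inter> C2 v = {}" if "u \<in> verts G" "v \<in> verts G" for u v
    using C1 C2 disj[OF that] that unfolding is_coloring_def by blast
  show "C1 v \<union> C2 v \<subseteq> L1 v \<union> L2 v" if "v \<in> verts G" for v
    using C1 C2 that unfolding is_coloring_def by blast
  show "card (C1 v \<union> C2 v) = w1 v + w2 v" if "v \<in> verts G" for v
  proof -
    have "finite (C1 v)" "finite (C2 v)"
      using finite_coloring[OF C1 that] finite_coloring[OF C2 that] fin[OF that] by blast+
    then show ?thesis
      using C1 C2 disjoint that by (simp add: card_Un_disjoint is_coloring_def)
  qed
  show "(C1 u \<union> C2 u) \<inter> (C1 v \<union> C2 v) = {}" if "u \<rightarrow>\<^bsub>G\<^esub> v" for u v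
    using C1 C2 that disjoint adj_in_verts[OF that] unfolding is_coloring_def by blast
qed

lemma (in wf_digraph) is_coloring_append:
  assumes C1: "is_coloring G (const_list a) w1 C1"
    and C2: "is_coloring G (const_list b) w2 C2"
  shows "is_coloring G (const_list (a + b)) (\<lambda>v. w1 v + w2 v) (\<lambda>v. C1 v \<union> (+) a ` C2 v)"
proof -
  have "is_coloring G (\<lambda>v. (+) a ` const_list b v) w2 (\<lambda>v. (+) a ` C2 v)"
    using is_coloring_image[OF C2] by simp
  then have "is_coloring G (\<lambda>v. const_list a v \<union> (+) a ` const_list b v)
      (\<lambda>v. w1 v + w2 v) (\<lambda>v. C1 v \<union> (+) a ` C2 v)"
    by (intro is_coloring_Un[OF C1]) (auto simp: const_list_def)
  then show ?thesis
    by (rule is_coloring_mono) (auto simp: const_list_def)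
qed

lemma (in wf_digraph) ex_coloring_between:
  assumes C1: "is_coloring G L w1 C1"
    and fin: "\<And>v. v \<in> verts G \<Longrightarrow> finite (L v)"
    and C0: "extends_coloring G C1 C0"
    and w: "\<And>v. v \<in> verts G \<Longrightarrow> card (C0 v) \<le> w v \<and> w v \<le> w1 v"
  shows "\<exists>C. is_coloring G L w C \<and> extends_coloring G C C0"
proof -
  have "\<exists>B. C0 v \<subseteq> B \<and> B \<subseteq> C1 v \<and> card B = w v" if "v \<in> verts G" for v
    using C0 C1 w[OF that] finite_coloring[OF C1 that fin[OF that]] that
    by (intro exists_subset_between) (auto simp: extends_coloring_def is_coloring_def)
  then obtain C where C: "C0 v \<subseteq> C v" "C v \<subseteq> C1 v" "card (C v) = w v" if "v \<in> verts G" for v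
    by metis
  have "C u \<inter> C v = {}" if "u \<rightarrow>\<^bsub>G\<^esub> v" for u v
    using C1 that C(2) adj_in_verts[OF that] unfolding is_coloring_def by blast
  then have "is_coloring G L w C"
    using C1 C(2,3) unfolding is_coloring_def by blast
  then show ?thesis
    using C(1) by (auto simp: extends_coloring_def)
qed

lemma (in digraph) ex_coloring_sum_weights:
  "\<exists>C. is_coloring G (const_list (\<Sum>v\<in>verts G. w v)) w C"
proof -
  define P where "P = (SIGMA v:verts G. {..<w v})"
  have "finite P" and card_P: "card P = (\<Sum>v\<in>verts G. w v)"
    by (simp_all add: P_def)
  then obtain h where h: "inj_on h P" "h ` P = {1..\<Sum>v\<in>verts G. w v}"
    using ex_bij_betw_nat_finite_1 bij_betw_inv unfolding bij_betw_def by metis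
  define C where "C v = h ` ({v} \<times> {..<w v})" for v
  have fibre: "{v} \<times> {..<w v} \<subseteq> P" if "v \<in> verts G" for v
    using that by (auto simp: P_def)
  have "C v \<subseteq> {1..\<Sum>v\<in>verts G. w v}" if "v \<in> verts G" for v
    using fibre[OF that] h(2) unfolding C_def by blast
  moreover have "card (C v) = w v" if "v \<in> verts G" for v
    unfolding C_def using card_image[OF inj_on_subset[OF h(1) fibre[OF that]]] by simp
  moreover have "C u \<inter> C v = {}" if "u \<rightarrow>\<^bsub>G\<^esub> v" for u v
  proof -
    have "({u} \<times> {..<w u}) \<inter> ({v} \<times> {..<w v}) = {}"
      using adj_not_same that by blast
    then show ?thesis
      unfolding C_def using inj_on_image_Int[OF h(1) fibre fibre] adj_in_verts[OF that]
      by (metis image_empty)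
  qed
  ultimately show ?thesis
    unfolding is_coloring_def const_list_def by blast
qed

lemma (in digraph) chromatic_number_attained:
  "1 \<le> chromatic_number G w \<and> (\<exists>C. is_coloring G (const_list (chromatic_number G w)) w C)"
proof -
  obtain C where "is_coloring G (const_list (\<Sum>v\<in>verts G. w v)) w C"
    using ex_coloring_sum_weights by blast
  then have "is_coloring G (const_list (Suc (\<Sum>v\<in>verts G. w v))) w C"
    by (rule is_coloring_mono) (auto simp: const_list_def)
  then have "\<exists>a. 1 \<le> a \<and> (\<exists>C. is_coloring G (const_list a) w C)"
    by (metis One_nat_def Suc_leI zero_less_Suc)
  then show ?thesis
    unfolding chromatic_number_def by (rule LeastI_ex)
qed

lemma chromatic_number_ext_le:
  assumes "is_coloring G L0 w0 C0" "is_coloring G (const_list a) w C" "extends_coloring G C C0"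
    and "1 \<le> a"
  shows "chromatic_number_ext G w w0 C0 \<le> a"
  unfolding chromatic_number_ext_def
  using assms in_sub_colorings_diff_iff[OF assms(2) _ assms(1)]
  by (intro Least_le) auto

lemma (in digraph) chromatic_number_ext_le_add_chromatic_number:
  assumes C0: "is_coloring G L0 w0 C0" and C1: "is_coloring G (const_list a) w1 C1"
    and ext: "extends_coloring G C1 C0" and w: "\<forall>v\<in>verts G. w0 v \<le> w v"
  shows "chromatic_number_ext G w w0 C0 \<le> a + chromatic_number G (\<lambda>v. w v - min (w v) (w1 v))"
proof -
  let ?d = "\<lambda>v. w v - min (w v) (w1 v)"
  obtain C2 where "1 \<le> chromatic_number G ?d"
    and C2: "is_coloring G (const_list (chromatic_number G ?d)) ?d C2"
    using chromatic_number_attained by blast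
  have "card (C0 v) \<le> min (w v) (w1 v)" if "v \<in> verts G" for v
    using C0 C1 ext w that card_mono[OF finite_coloring[OF C1 that], of "C0 v"]
    by (simp add: is_coloring_def extends_coloring_def)
  then obtain B where B: "is_coloring G (const_list a) (\<lambda>v. min (w v) (w1 v)) B"
    and "extends_coloring G B C0"
    using ex_coloring_between[OF C1 _ ext, of "\<lambda>v. min (w v) (w1 v)"] by auto
  then have "extends_coloring G (\<lambda>v. B v \<union> (+) a ` C2 v) C0"
    by (auto simp: extends_coloring_def)
  moreover have "is_coloring G (const_list (a + chromatic_number G ?d)) w
      (\<lambda>v. B v \<union> (+) a ` C2 v)"
    using is_coloring_append[OF B C2] by simp
  ultimately show ?thesis
    using C0 \<open>1 \<le> chromatic_number G ?d\<close> by (intro chromatic_number_ext_le) auto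
qed

definition maximal_coloring ::
  "('a,'b) pre_digraph \<Rightarrow> ('a \<Rightarrow> nat set) \<Rightarrow> ('a \<Rightarrow> nat set) \<Rightarrow> bool" where
  "maximal_coloring G L C \<longleftrightarrow>
     (\<forall>x. maximal_independent_set (color_subgraph G L x) (color_class G C x))"

lemma (in fin_digraph) ex_maximal_coloring_extending:
  assumes "is_coloring G L w0 C0"
  shows "\<exists>C. maximal_coloring G L C \<and> extends_coloring G C C0"
proof -
  have "finite (verts (color_subgraph G L x))" for x
    by (simp add: color_subgraph_def)
  then have "\<exists>M. color_class G C0 x \<subseteq> M \<and> maximal_independent_set (color_subgraph G L x) M" for x
    using assms
    by (intro ex_maximal_independent_superset) (auto simp: is_coloring_iff_independent_color_classes)
  then obtain M where class_subset: "\<And>x. color_class G C0 x \<subseteq> M x"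
    and maximal: "\<And>x. maximal_independent_set (color_subgraph G L x) (M x)"
    by metis
  have "M x \<subseteq> verts G" for x
    using maximal[of x]
    by (auto simp: maximal_independent_set_def independent_set_def color_subgraph_def)
  then have "color_class G (\<lambda>v. {x. v \<in> M x}) x = M x" for x
    by (auto simp: color_class_def)
  then have "maximal_coloring G L (\<lambda>v. {x. v \<in> M x})"
    by (simp add: maximal_coloring_def maximal)
  moreover have "extends_coloring G (\<lambda>v. {x. v \<in> M x}) C0"
    using class_subset by (auto simp: extends_coloring_def color_class_def)
  ultimately show ?thesis by blast
qed

lemma (in fin_digraph) maximal_coloring_weight_in_W_max:
  assumes maximal: "maximal_coloring G L C" and fin: "\<And>v. v \<in> verts G \<Longrightarrow> finite (L v)"
  shows "\<exists>w\<in>W_max G L. is_coloring G L w C"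
proof
  define X where "X = (\<Union>v\<in>verts G. L v)"
  define w :: "'a \<Rightarrow> nat" where "w = (\<Sum>x\<in>X. indicator (color_class G C x))"
  show "w \<in> W_max G L"
    unfolding W_max_def X_def[symmetric] w_def
    using maximal by (intro sum_in_set_sum) (auto simp: MIS_vec_def maximal_coloring_def)
  have independent: "independent_set (color_subgraph G L x) (color_class G C x)" for x
    using maximal by (simp add: maximal_coloring_def maximal_independent_set_def)
  have "card (C v) = w v" if "v \<in> verts G" for v
  proof -
    have "C v \<subseteq> X"
      using independent that
      by (auto simp: X_def independent_set_color_subgraph_iff color_class_def)
    have "w v = (\<Sum>x\<in>X. indicator (C v) x)"
      using that by (simp add: w_def sum_apply indicator_def color_class_def)
    also have "\<dots> = card (X \<inter> C v)"
      using fin by (intro sum_indicator_eq_card) (simp add: X_def)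
    also have "X \<inter> C v = C v"
      using \<open>C v \<subseteq> X\<close> by blast
    finally show ?thesis by simp
  qed
  then show "is_coloring G L w C"
    using independent by (simp add: is_coloring_iff_independent_color_classes)
qed

lemma in_W_max_ext_iff:
  assumes "is_coloring G L' w0 C0" "\<And>v. v \<in> verts G \<Longrightarrow> finite (L v)"
  shows "w1 \<in> W_max_ext G L w0 C0 \<longleftrightarrow>
    w1 \<in> W_max G L \<and> (\<exists>C1. is_coloring G L w1 C1 \<and> extends_coloring G C1 C0)"
  using in_sub_colorings_diff_iff[OF _ assms(2,1)] by (auto simp: W_max_ext_def)

lemma (in fin_digraph) W_max_ext_nonempty:
  assumes C0: "is_coloring G L w0 C0" and fin: "\<And>v. v \<in> verts G \<Longrightarrow> finite (L v)"
  shows "W_max_ext G L w0 C0 \<noteq> {}"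
proof -
  obtain C1 where "maximal_coloring G L C1" "extends_coloring G C1 C0"
    using ex_maximal_coloring_extending[OF C0] by blast
  moreover from this obtain w1 where "w1 \<in> W_max G L" "is_coloring G L w1 C1"
    using maximal_coloring_weight_in_W_max fin by blast
  ultimately have "w1 \<in> W_max_ext G L w0 C0"
    using in_W_max_ext_iff[OF C0, of L] fin by blast
  then show ?thesis by blast
qed

theorem theorem7p1:
  fixes G :: "('a,'b) pre_digraph"
    and w0 w :: "'a \<Rightarrow> nat"
    and C0 :: "'a \<Rightarrow> nat set"
    and a0 :: nat
  assumes "graph G"
    and "a0 = chromatic_number G w0"
    and "is_coloring G (const_list a0) w0 C0"
    and "\<forall>v \<in> verts G. w0 v \<le> w v"
  shows "chromatic_number_ext G w w0 C0
           \<le> a0 + Min (chromatic_number G ` delta_vec G (const_list a0) w0 C0 w)"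
proof -
  interpret graph G by fact
  let ?W = "W_max_ext G (const_list a0) w0 C0"
  let ?D = "delta_vec G (const_list a0) w0 C0 w"
  have D: "?D = (\<lambda>w1 v. w v - min (w v) (w1 v)) ` ?W"
    by (auto simp: delta_vec_def)
  have "finite ?W" "?W \<noteq> {}"
    using finite_W_max W_max_ext_nonempty[OF assms(3) finite_const_list] by (simp_all add: W_max_ext_def)
  then have "Min (chromatic_number G ` ?D) \<in> chromatic_number G ` ?D"
    by (intro Min_in) (simp_all add: D)
  then obtain w1 where "w1 \<in> ?W"
    and Min_eq: "Min (chromatic_number G ` ?D) = chromatic_number G (\<lambda>v. w v - min (w v) (w1 v))"
    by (auto simp: D)
  then obtain C1 where "is_coloring G (const_list a0) w1 C1" "extends_coloring G C1 C0"
    using in_W_max_ext_iff[OF assms(3), of "const_list a0"] by auto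
  then show ?thesis
    unfolding Min_eq by (rule chromatic_number_ext_le_add_chromatic_number[OF assms(3) _ _ assms(4)])
qed

end
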